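(* Let $t\ge r\ge 1$ be integers and let $G_{m,n,k}$ be the $m\times n\times k$ three-dimensional grid graph, with $m,n,k$ positive integers. Let $B$ be the number of $(t,r)$ starting blocks required to construct a 3D grid graph that completely covers $G_{m,n,k}$, in the sense that every edge and every vertex of $G_{m,n,k}$ belongs to at least one of the $B$ starting blocks. Then, each starting block being efficiently $(t,r)$ dominated by $2$ towers, \[\gamma_{t,r}(G_{m,n,k})\le 2\cdot B .\]
   Context: The 3D grid graph $G_{m,n,k}$ has as vertices the integer points of an $m\times n\times k$ box in $\mathbb Z^3$, with edges joining vertices at distance $1$. For a connected graph $G$ with vertex set $V(G)$ and graph distance $d$, and a set $\mathbb T\subseteq V(G)$ (whose elements are called towers, of strength $t$), the signal received by $v\in V(G)$ is $f(v)=\sum_{w\in\mathbb T}\max\{0,\,t-d(v,w)\}$ (a tower also receives its own signal). The set $\mathbb T$ is a $(t,r)$ broadcast dominating set if $f(v)\ge r$ for every $v\in V(G)$; $\gamma_{t,r}(G)$ is the minimum cardinality of such a set. The broadcast zone of a tower $w$ is $\{v: d(v,w)\le t-1\}$, and the overlap is the set of vertices lying in the broadcast zones of more than one tower. A $(t,r)$ broadcast dominating set is efficient if every vertex in the overlap receives signal exactly $r$. A $(t,r)$ starting block is a grid graph (here, the grid graph on an axis-parallel box of integer points in $\mathbb Z^3$) that is efficiently $(t,r)$ dominated by two towers of strength $t$. *)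

theory Defs
  imports Complex_Main
begin

record 'a graph =
  verts :: "'a set"
  edges :: "'a set set"

text \<open>An edge is the set of its two endpoints. The distance is the length of a shortest walk;
  it is a junk value if there is no walk, so it is only meaningful in a connected graph.\<close>

definition gdist :: "'a graph \<Rightarrow> 'a \<Rightarrow> 'a \<Rightarrow> nat" where
  "gdist G u v = (LEAST l. (u, v) \<in> {(x, y). {x, y} \<in> edges G} ^^ l)"

text \<open>Truncated subtraction on \<open>nat\<close> is the $\max\{0, t - d(v,w)\}$ of the signal.\<close>

definition signal :: "nat \<Rightarrow> 'a graph \<Rightarrow> 'a set \<Rightarrow> 'a \<Rightarrow> nat" where
  "signal t G T v = (\<Sum>w\<in>T. t - gdist G v w)"

text \<open>Finiteness is automatic in a finite graph. In an infinite one it excludes infinite tower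
  sets, whose \<open>card\<close> and \<open>signal\<close> would be 0 by convention.\<close>

definition broadcast_dominating :: "nat \<Rightarrow> nat \<Rightarrow> 'a graph \<Rightarrow> 'a set \<Rightarrow> bool" where
  "broadcast_dominating t r G T \<longleftrightarrow>
     finite T \<and> T \<subseteq> verts G \<and> (\<forall>v\<in>verts G. r \<le> signal t G T v)"

definition broadcast_domination_number :: "nat \<Rightarrow> nat \<Rightarrow> 'a graph \<Rightarrow> nat" where
  "broadcast_domination_number t r G = Inf {card T | T. broadcast_dominating t r G T}"

text \<open>Distance at most $t - 1$, written so that \<open>t = 0\<close> gives the empty zone.\<close>

definition broadcast_zone :: "nat \<Rightarrow> 'a graph \<Rightarrow> 'a \<Rightarrow> 'a set" where
  "broadcast_zone t G w = {v \<in> verts G. gdist G v w < t}"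

definition overlap :: "nat \<Rightarrow> 'a graph \<Rightarrow> 'a set \<Rightarrow> 'a set" where
  "overlap t G T =
     {v. \<exists>w\<in>T. \<exists>w'\<in>T. w \<noteq> w' \<and> v \<in> broadcast_zone t G w \<and> v \<in> broadcast_zone t G w'}"

definition efficiently_dominating :: "nat \<Rightarrow> nat \<Rightarrow> 'a graph \<Rightarrow> 'a set \<Rightarrow> bool" where
  "efficiently_dominating t r G T \<longleftrightarrow>
     broadcast_dominating t r G T \<and> (\<forall>v\<in>overlap t G T. signal t G T v = r)"

fun unit_distance :: "int \<times> int \<times> int \<Rightarrow> int \<times> int \<times> int \<Rightarrow> bool" where
  "unit_distance (x, y, z) (x', y', z') \<longleftrightarrow> (x - x')\<^sup>2 + (y - y')\<^sup>2 + (z - z')\<^sup>2 = 1"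

text \<open>The grid graph on the axis-parallel $m \times n \times k$ box with least corner $(a,b,c)$.\<close>

fun box_verts :: "int \<times> int \<times> int \<Rightarrow> nat \<Rightarrow> nat \<Rightarrow> nat \<Rightarrow> (int \<times> int \<times> int) set" where
  "box_verts (a, b, c) m n k = {a..<a + int m} \<times> {b..<b + int n} \<times> {c..<c + int k}"

definition box_graph :: "int \<times> int \<times> int \<Rightarrow> nat \<Rightarrow> nat \<Rightarrow> nat \<Rightarrow> (int \<times> int \<times> int) graph" where
  "box_graph p m n k =
     \<lparr>verts = box_verts p m n k,
      edges = {{u, v} | u v. u \<in> box_verts p m n k \<and> v \<in> box_verts p m n k \<and> unit_distance u v}\<rparr>"

definition grid_graph :: "nat \<Rightarrow> nat \<Rightarrow> nat \<Rightarrow> (int \<times> int \<times> int) graph" where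
  "grid_graph = box_graph (0, 0, 0)"

definition starting_block :: "nat \<Rightarrow> nat \<Rightarrow> (int \<times> int \<times> int) graph \<Rightarrow> bool" where
  "starting_block t r H \<longleftrightarrow>
     (\<exists>p m n k. 0 < m \<and> 0 < n \<and> 0 < k \<and> H = box_graph p m n k) \<and>
     (\<exists>T. card T = 2 \<and> efficiently_dominating t r H T)"

text \<open>The blocks are placed in $\mathbb Z^3$, may have different shapes, may overlap, and may
  stick out of the covered graph.\<close>

definition covering_blocks ::
  "nat \<Rightarrow> nat \<Rightarrow> (int \<times> int \<times> int) graph \<Rightarrow> (int \<times> int \<times> int) graph set \<Rightarrow> bool" where
  "covering_blocks t r G F \<longleftrightarrow>
     finite F \<and> (\<forall>H\<in>F. starting_block t r H) \<and>
     (\<forall>v\<in>verts G. \<exists>H\<in>F. v \<in> verts H) \<and>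
     (\<forall>e\<in>edges G. \<exists>H\<in>F. e \<in> edges H)"

definition starting_blocks_required :: "nat \<Rightarrow> nat \<Rightarrow> (int \<times> int \<times> int) graph \<Rightarrow> nat" where
  "starting_blocks_required t r G = Inf {card F | F. covering_blocks t r G F}"

end

theory Submission imports Defs begin

text \<open>Distances in a box are \<open>\<ell>\<^sub>1\<close>-distances, and the coordinatewise projection \<open>w\<close> of a point
  \<open>p\<close> to the box of the covered graph satisfies \<open>d(v,p) = d(v,w) + d(w,p)\<close> for all \<open>v\<close> in that box.
  So the two towers of a block may be replaced by their projections without weakening the signal,
  provided these are distinct. If they coincide, in \<open>w\<close> say, then at least one of the two towers
  was moved, by a distance of at least 1, and \<open>w\<close> together with any neighbour of \<open>w\<close> (or alone, if
  it is the only vertex) can replace them. This gives at most two towers per block. That a cover exists at all is seen from the blocks that are paths with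
  \<open>2t - r\<close> edges and the towers at the two ends: every vertex has total distance \<open>2t - r\<close> to the
  towers.\<close>

section \<open>The taxicab metric on integer points and distances in box graphs\<close>

fun l1dist :: "int \<times> int \<times> int \<Rightarrow> int \<times> int \<times> int \<Rightarrow> nat" where
  "l1dist (x, y, z) (x', y', z') = nat (\<bar>x - x'\<bar> + \<bar>y - y'\<bar> + \<bar>z - z'\<bar>)"

lemma l1dist_commute: "l1dist u v = l1dist v u"
  by (cases u; cases v) (simp add: abs_minus_commute)

lemma l1dist_triangle: "l1dist u w \<le> l1dist u v + l1dist v w"
proof -
  have "\<bar>i - l\<bar> \<le> \<bar>i - j\<bar> + \<bar>j - l\<bar>" for i j l :: int
    by linarith
  then have "\<bar>x - x''\<bar> + \<bar>y - y''\<bar> + \<bar>z - z''\<bar> \<le>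
      (\<bar>x - x'\<bar> + \<bar>x' - x''\<bar>) + (\<bar>y - y'\<bar> + \<bar>y' - y''\<bar>) + (\<bar>z - z'\<bar> + \<bar>z' - z''\<bar>)"
    for x y z x' y' z' x'' y'' z'' :: int
    by (intro add_mono)
  then show ?thesis
    by (cases u; cases v; cases w) (simp add: nat_add_distrib[symmetric] nat_mono ac_simps)
qed

lemma l1dist_self [simp]: "l1dist v v = 0"
  by (cases v) simp

lemma l1dist_eq_0_iff [simp]: "l1dist u v = 0 \<longleftrightarrow> u = v"
  by (cases u; cases v) auto

text \<open>Integrality forces exactly one summand to carry the whole sum. For absolute coordinate
  differences this says that an edge runs along one axis.\<close>

lemma nonneg_sum_eq_1:
  fixes i j l :: int
  assumes "i + j + l = 1" "0 \<le> i" "0 \<le> j" "0 \<le> l"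
  shows "(i = 1 \<and> j = 0 \<and> l = 0) \<or> (i = 0 \<and> j = 1 \<and> l = 0) \<or> (i = 0 \<and> j = 0 \<and> l = 1)"
  using assms by linarith

lemma unit_distance_iff_l1dist: "unit_distance u v \<longleftrightarrow> l1dist u v = 1"
proof -
  have "a\<^sup>2 + b\<^sup>2 + c\<^sup>2 = 1 \<longleftrightarrow> \<bar>a\<bar> + \<bar>b\<bar> + \<bar>c\<bar> = 1" for a b c :: int
  proof
    \<comment> \<open>Integers satisfy \<open>\<bar>i\<bar> \<le> i\<^sup>2\<close>, which bounds
      the taxicab length by 1; it is not 0, as the squares do not all vanish.\<close>
    have le: "\<bar>i\<bar> \<le> i\<^sup>2" for i :: int
      using self_le_power[of "\<bar>i\<bar>" 2] by (cases "i = 0") auto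
    assume *: "a\<^sup>2 + b\<^sup>2 + c\<^sup>2 = 1"
    then have "\<bar>a\<bar> + \<bar>b\<bar> + \<bar>c\<bar> \<le> 1"
      using le[of a] le[of b] le[of c] by linarith
    moreover have "a \<noteq> 0 \<or> b \<noteq> 0 \<or> c \<noteq> 0"
      using * by auto
    ultimately show "\<bar>a\<bar> + \<bar>b\<bar> + \<bar>c\<bar> = 1"
      by linarith
  next
    assume "\<bar>a\<bar> + \<bar>b\<bar> + \<bar>c\<bar> = 1"
    then show "a\<^sup>2 + b\<^sup>2 + c\<^sup>2 = 1"
      using nonneg_sum_eq_1[of "\<bar>a\<bar>" "\<bar>b\<bar>" "\<bar>c\<bar>"] by (auto simp: abs_square_eq_1)
  qed
  then show ?thesis
    by (cases u; cases v) auto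
qed

lemma verts_box_graph [simp]: "verts (box_graph p m n k) = box_verts p m n k"
  by (simp add: box_graph_def)

lemma edge_box_graph_iff:
  "{u, v} \<in> edges (box_graph p m n k) \<longleftrightarrow>
     u \<in> box_verts p m n k \<and> v \<in> box_verts p m n k \<and> l1dist u v = 1"
  unfolding box_graph_def unit_distance_iff_l1dist graph.simps mem_Collect_eq doubleton_eq_iff
  by (metis l1dist_commute)

text \<open>Moving one coordinate in which \<open>u\<close> and \<open>v\<close> differ by 1 towards
  \<open>v\<close> stays between the two points, hence in the box. Iterating this gives shortest
  walks.\<close>

lemma box_step_towards:
  assumes "u \<in> box_verts p m n k" "v \<in> box_verts p m n k" "u \<noteq> v"
  obtains w where "w \<in> box_verts p m n k" "l1dist u w = 1" "l1dist u v = Suc (l1dist w v)"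
proof -
  obtain a b c x y z x' y' z' where
    eq: "p = (a, b, c)" "u = (x, y, z)" "v = (x', y', z')"
    by (metis prod_cases3)
  have "x \<noteq> x' \<or> y \<noteq> y' \<or> z \<noteq> z'"
    using assms(3) eq by auto
  then consider "x < x'" | "x' < x" | "y < y'" | "y' < y" | "z < z'" | "z' < z"
    by linarith
  then show ?thesis
  proof cases
    case 1
    then show ?thesis using assms eq by (intro that[of "(x + 1, y, z)"]) auto
  next
    case 2
    then show ?thesis using assms eq by (intro that[of "(x - 1, y, z)"]) auto
  next
    case 3
    then show ?thesis using assms eq by (intro that[of "(x, y + 1, z)"]) auto
  next
    case 4
    then show ?thesis using assms eq by (intro that[of "(x, y - 1, z)"]) auto
  next
    case 5
    then show ?thesis using assms eq by (intro that[of "(x, y, z + 1)"]) auto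
  next
    case 6
    then show ?thesis using assms eq by (intro that[of "(x, y, z - 1)"]) auto
  qed
qed

lemma gdist_box_graph:
  assumes "u \<in> box_verts p m n k" "v \<in> box_verts p m n k"
  shows "gdist (box_graph p m n k) u v = l1dist u v"
proof -
  define R where "R = {(x, y). {x, y} \<in> edges (box_graph p m n k)}"
  have "(u, v) \<in> R ^^ l1dist u v"
    using assms
  proof (induction "l1dist u v" arbitrary: u)
    case 0
    then show ?case
      by (metis l1dist_eq_0_iff relpow_0_I)
  next
    case (Suc l)
    then have "u \<noteq> v"
      by auto
    then obtain w where w: "w \<in> box_verts p m n k" "l1dist u w = 1" "l1dist u v = Suc (l1dist w v)"
      using box_step_towards[OF Suc.prems] by blast
    then have "(u, w) \<in> R"
      using Suc.prems by (simp add: R_def edge_box_graph_iff)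
    moreover have "(w, v) \<in> R ^^ l1dist w v"
      using Suc w by simp
    ultimately show ?case
      unfolding w(3) by (rule relpow_Suc_I2)
  qed
  \<comment> \<open>Each edge has taxicab length 1, so by the triangle inequality no walk is shorter
    than the taxicab distance.\<close>
  moreover have "l1dist u v \<le> l" if "(u, v) \<in> R ^^ l" for l
    using that
  proof (induction l arbitrary: v)
    case (Suc l)
    then obtain w where "(u, w) \<in> R ^^ l" "(w, v) \<in> R"
      by auto
    then show ?case
      using Suc.IH l1dist_triangle[of u v w]
      by (fastforce simp: R_def edge_box_graph_iff)
  qed simp
  ultimately show ?thesis
    unfolding gdist_def R_def[symmetric] by (rule Least_equality)
qed

lemma signal_box_graph:
  assumes "T \<subseteq> box_verts p m n k" "v \<in> box_verts p m n k"
  shows "signal t (box_graph p m n k) T v = (\<Sum>w\<in>T. t - l1dist v w)"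
  unfolding signal_def by (rule sum.cong) (use assms in \<open>auto simp: gdist_box_graph\<close>)

lemma finite_box_verts [simp]: "finite (box_verts p m n k)"
  by (cases p) auto

section \<open>Projecting the towers of a block into the covered box\<close>

lemma box_projection:
  assumes "0 < m" "0 < n" "0 < k"
  obtains w where "w \<in> box_verts q m n k"
    "\<And>v. v \<in> box_verts q m n k \<Longrightarrow> l1dist v p = l1dist v w + l1dist w p"
proof -
  obtain a b c x y z where eq: "q = (a, b, c)" "p = (x, y, z)"
    by (metis prod_cases3)
  \<comment> \<open>Clamping to an interval. The clamped value lies between \<open>x\<close> and
    every \<open>i\<close> of the interval, so the distance from \<open>i\<close> to
    \<open>x\<close> splits there.\<close>
  define proj :: "int \<Rightarrow> nat \<Rightarrow> int \<Rightarrow> int"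
    where "proj a m x = max a (min (a + int m - 1) x)" for a m x
  have proj: "proj a m x \<in> {a..<a + int m}" if "0 < m" for a m x
    using that by (auto simp: proj_def)
  have add: "\<bar>i - x\<bar> = \<bar>i - proj a m x\<bar> + \<bar>proj a m x - x\<bar>" if "i \<in> {a..<a + int m}" for i a m x
    using that by (auto simp: proj_def)
  have nat_add: "nat ((i + i') + (j + j') + (l + l')) = nat (i + j + l) + nat (i' + j' + l')"
    if "0 \<le> i" "0 \<le> i'" "0 \<le> j" "0 \<le> j'" "0 \<le> l" "0 \<le> l'" for i i' j j' l l' :: int
    using that by linarith
  show ?thesis
  proof (rule that[of "(proj a m x, proj b n y, proj c k z)"])
    show "(proj a m x, proj b n y, proj c k z) \<in> box_verts q m n k"
      using assms proj by (simp add: eq)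
    fix v
    assume "v \<in> box_verts q m n k"
    moreover obtain i j l where "v = (i, j, l)"
      by (metis prod_cases3)
    ultimately have v: "v = (i, j, l)"
      "i \<in> {a..<a + int m}" "j \<in> {b..<b + int n}" "l \<in> {c..<c + int k}"
      by (simp_all add: eq)
    show "l1dist v p = l1dist v (proj a m x, proj b n y, proj c k z) +
        l1dist (proj a m x, proj b n y, proj c k z) p"
      unfolding v(1) eq l1dist.simps add[OF v(2), of x] add[OF v(3), of y] add[OF v(4), of z]
      by (rule nat_add) simp_all
  qed
qed

text \<open>The bound is \<open>card S \<le> 2\<close> and not an equality because a box with a
  single vertex has room for only one tower.\<close>

lemma starting_block_replacement:
  assumes pos: "0 < m" "0 < n" "0 < k" and "r \<le> t" and H: "starting_block t r H"
  obtains S where "S \<subseteq> box_verts q m n k" "card S \<le> 2"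
    "\<And>v. v \<in> box_verts q m n k \<Longrightarrow> v \<in> verts H \<Longrightarrow> r \<le> (\<Sum>w\<in>S. t - l1dist v w)"
proof -
  let ?V = "box_verts q m n k"
  obtain p m' n' k' T where H_eq: "H = box_graph p m' n' k'"
    and "card T = 2" and "efficiently_dominating t r H T"
    using H unfolding starting_block_def by blast
  then have T: "T \<subseteq> verts H" "\<And>v. v \<in> verts H \<Longrightarrow> r \<le> signal t H T v"
    unfolding efficiently_dominating_def broadcast_dominating_def by auto
  obtain x y where xy: "T = {x, y}" "x \<noteq> y"
    using \<open>card T = 2\<close> by (meson card_2_iff)
  have dom: "r \<le> (t - l1dist v x) + (t - l1dist v y)" if "v \<in> verts H" for v
    using T(1) T(2)[OF that] that xy signal_box_graph[of T p m' n' k' v t] by (simp add: H_eq)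
  obtain x' where x': "x' \<in> ?V" "\<And>v. v \<in> ?V \<Longrightarrow> l1dist v x = l1dist v x' + l1dist x' x"
    using box_projection[OF pos] by blast
  obtain y' where y': "y' \<in> ?V" "\<And>v. v \<in> ?V \<Longrightarrow> l1dist v y = l1dist v y' + l1dist y' y"
    using box_projection[OF pos] by blast
  consider "x' \<noteq> y'" | "x' = y'" "?V = {x'}" | u where "x' = y'" "u \<in> ?V" "x' \<noteq> u"
    using x'(1) by blast
  then show ?thesis
  proof cases
    case 1
    show ?thesis
    proof (rule that[of "{x', y'}"])
      fix v
      assume "v \<in> ?V" "v \<in> verts H"
      then show "r \<le> (\<Sum>w\<in>{x', y'}. t - l1dist v w)"
        using 1 dom[of v] x'(2)[of v] y'(2)[of v] by simp
    qed (use 1 x' y' in auto)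
  next
    case 2
    show ?thesis
    proof (rule that[of "{x'}"])
      fix v
      assume "v \<in> ?V"
      \<comment> \<open>Here \<open>v = x'\<close>, so the tower gives its full strength
        \<open>t\<close> to its own vertex.\<close>
      then show "r \<le> (\<Sum>w\<in>{x'}. t - l1dist v w)"
        using 2 \<open>r \<le> t\<close> by simp
    qed (use x' in auto)
  next
    case 3
    \<comment> \<open>A second vertex \<open>u\<close> only serves to show that \<open>x'\<close>
      has a neighbour in the box: the first step towards \<open>u\<close>.\<close>
    then obtain w where w: "w \<in> ?V" "l1dist x' w = 1"
      using box_step_towards[OF x'(1)] by blast
    then have "x' \<noteq> w"
      by auto
    show ?thesis
    proof (rule that[of "{x', w}"])
      fix v
      assume v: "v \<in> ?V" "v \<in> verts H"
      \<comment> \<open>Distinct towers cannot both sit at \<open>x'\<close>. The one that was moved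
        was at least 1 farther from \<open>v\<close> than \<open>x'\<close> is, and \<open>w\<close>
        is at most 1 farther, so \<open>w\<close> can stand in for it and \<open>x'\<close> for the
        other.\<close>
      have "l1dist x' x \<noteq> 0 \<or> l1dist x' y \<noteq> 0"
        using \<open>x \<noteq> y\<close> by auto
      moreover have "l1dist v w \<le> l1dist v x' + 1"
        using l1dist_triangle[of v w x'] w by simp
      ultimately have "r \<le> (t - l1dist v x') + (t - l1dist v w)"
        using dom[OF v(2)] x'(2)[OF v(1)] y'(2)[OF v(1)] unfolding 3(1) by linarith
      then show "r \<le> (\<Sum>w\<in>{x', w}. t - l1dist v w)"
        using \<open>x' \<noteq> w\<close> by simp
    qed (use x' w in \<open>auto simp: card_insert_if\<close>)
  qed
qed

text \<open>Take the union of the replacement sets. Taxicab distances do not depend on the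
  surrounding box, so each vertex already receives enough signal from the set of one block
  containing it. Sets of different blocks may meet, which only lowers the cardinality.\<close>

lemma covering_blocks_dominating:
  assumes "0 < m" "0 < n" "0 < k" "r \<le> t" and F: "covering_blocks t r (box_graph q m n k) F"
  obtains T where "broadcast_dominating t r (box_graph q m n k) T" "card T \<le> 2 * card F"
proof -
  let ?V = "box_verts q m n k"
  let ?ok = "\<lambda>H S. S \<subseteq> ?V \<and> card S \<le> 2 \<and>
    (\<forall>v\<in>?V. v \<in> verts H \<longrightarrow> r \<le> (\<Sum>w\<in>S. t - l1dist v w))"
  have "\<forall>H\<in>F. \<exists>S. ?ok H S"
  proof
    fix H
    assume "H \<in> F"
    then have "starting_block t r H"
      using F by (simp add: covering_blocks_def)
    then show "\<exists>S. ?ok H S"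
      by (rule starting_block_replacement[OF assms(1-4), where q = q]) blast
  qed
  then obtain S where "\<forall>H\<in>F. ?ok H (S H)"
    by (rule bchoice[THEN exE])
  then have S: "\<And>H. H \<in> F \<Longrightarrow> S H \<subseteq> ?V" "\<And>H. H \<in> F \<Longrightarrow> card (S H) \<le> 2"
    "\<And>H v. H \<in> F \<Longrightarrow> v \<in> ?V \<Longrightarrow> v \<in> verts H \<Longrightarrow> r \<le> (\<Sum>w\<in>S H. t - l1dist v w)"
    by blast+
  let ?T = "\<Union>H\<in>F. S H"
  have sub: "?T \<subseteq> ?V"
    using S(1) by blast
  have fin: "finite ?T"
    using sub finite_box_verts by (rule finite_subset)
  show ?thesis
  proof (rule that[of ?T])
    have "r \<le> signal t (box_graph q m n k) ?T v" if v: "v \<in> ?V" for v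
    proof -
      obtain H where H: "H \<in> F" "v \<in> verts H"
        using F v unfolding covering_blocks_def by auto
      have "r \<le> (\<Sum>w\<in>S H. t - l1dist v w)"
        using S(3) H v by blast
      also have "\<dots> \<le> (\<Sum>w\<in>?T. t - l1dist v w)"
        by (rule sum_mono2) (use fin H in auto)
      finally show ?thesis
        using signal_box_graph[OF sub v] by simp
    qed
    then show "broadcast_dominating t r (box_graph q m n k) ?T"
      unfolding broadcast_dominating_def using sub fin by auto
    have "finite F"
      using F by (simp add: covering_blocks_def)
    then have "card ?T \<le> (\<Sum>H\<in>F. card (S H))"
      by (rule card_UN_le)
    also have "\<dots> \<le> (\<Sum>H\<in>F. 2)"
      by (rule sum_mono) (rule S(2))
    finally show "card ?T \<le> 2 * card F"
      by simp
  qed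
qed

section \<open>Existence of a cover by path blocks\<close>

lemma starting_block_geodesic:
  assumes "1 \<le> r" "r \<le> t" "x \<in> box_verts p m n k" "y \<in> box_verts p m n k"
    and geodesic: "\<And>v. v \<in> box_verts p m n k \<Longrightarrow> l1dist v x + l1dist v y = 2 * t - r"
  shows "starting_block t r (box_graph p m n k)"
proof -
  have pos: "0 < m" "0 < n" "0 < k"
    using assms(3) by (cases p; auto)+
  have "x \<noteq> y"
    using geodesic[OF assms(4)] assms(1,2) by auto
  have sub: "{x, y} \<subseteq> box_verts p m n k"
    using assms by simp
  have signal: "signal t (box_graph p m n k) {x, y} v = (t - l1dist v x) + (t - l1dist v y)"
    if "v \<in> box_verts p m n k" for v
    using signal_box_graph[OF sub that] \<open>x \<noteq> y\<close> by simp
  \<comment> \<open>Without truncation the two contributions would add up to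
    \<open>2 * t - (2 * t - r) = r\<close>; truncation at 0 can only raise the sum.\<close>
  have "r \<le> signal t (box_graph p m n k) {x, y} v" if "v \<in> box_verts p m n k" for v
    using signal[OF that] geodesic[OF that] assms(1,2) by arith
  moreover have "signal t (box_graph p m n k) {x, y} v = r"
    if "v \<in> overlap t (box_graph p m n k) {x, y}" for v
  proof -
    \<comment> \<open>In the overlap both distances are below \<open>t\<close>, so nothing is
      truncated and the sum is exactly \<open>r\<close>.\<close>
    have v: "v \<in> box_verts p m n k" and "l1dist v x < t" "l1dist v y < t"
      using that assms(3,4) by (auto simp: overlap_def broadcast_zone_def gdist_box_graph)
    then show ?thesis
      using signal[OF v] geodesic[OF v] assms(1,2) by arith
  qed
  ultimately have "efficiently_dominating t r (box_graph p m n k) {x, y}"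
    unfolding efficiently_dominating_def broadcast_dominating_def using sub by auto
  moreover have "card {x, y} = 2"
    using \<open>x \<noteq> y\<close> by simp
  ultimately show ?thesis
    unfolding starting_block_def using pos by blast
qed

lemma starting_block_path:
  assumes "1 \<le> r" "r \<le> t"
  shows "starting_block t r (box_graph (a, b, c) (2 * t - r + 1) 1 1)"
    and "starting_block t r (box_graph (a, b, c) 1 (2 * t - r + 1) 1)"
    and "starting_block t r (box_graph (a, b, c) 1 1 (2 * t - r + 1))"
proof -
  let ?D = "int (2 * t - r)"
  show "starting_block t r (box_graph (a, b, c) (2 * t - r + 1) 1 1)"
    by (rule starting_block_geodesic[OF assms, of "(a, b, c)" _ _ _ _ "(a + ?D, b, c)"]) auto
  show "starting_block t r (box_graph (a, b, c) 1 (2 * t - r + 1) 1)"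
    by (rule starting_block_geodesic[OF assms, of "(a, b, c)" _ _ _ _ "(a, b + ?D, c)"]) auto
  show "starting_block t r (box_graph (a, b, c) 1 1 (2 * t - r + 1))"
    by (rule starting_block_geodesic[OF assms, of "(a, b, c)" _ _ _ _ "(a, b, c + ?D)"]) auto
qed

lemma starting_block_edge:
  assumes rt: "1 \<le> r" "r \<le> t" and "l1dist u v = 1"
  obtains p m n k where "starting_block t r (box_graph p m n k)"
    "u \<in> box_verts p m n k" "v \<in> box_verts p m n k"
proof -
  define d where "d = 2 * t - r + 1"
  \<comment> \<open>The path along the axis of the edge starts at the smaller endpoint; having at
    least two vertices, it contains the other one too.\<close>
  have d: "2 \<le> d"
    using rt by (simp add: d_def)
  obtain x y z x' y' z' where eq: "u = (x, y, z)" "v = (x', y', z')"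
    by (metis prod_cases3)
  then have "\<bar>x - x'\<bar> + \<bar>y - y'\<bar> + \<bar>z - z'\<bar> = 1"
    using assms(3) by simp
  then consider "\<bar>x - x'\<bar> = 1" "y = y'" "z = z'" | "x = x'" "\<bar>y - y'\<bar> = 1" "z = z'"
    | "x = x'" "y = y'" "\<bar>z - z'\<bar> = 1"
    using nonneg_sum_eq_1[of "\<bar>x - x'\<bar>" "\<bar>y - y'\<bar>" "\<bar>z - z'\<bar>"] by auto
  then show ?thesis
  proof cases
    case 1
    show ?thesis
      by (rule that[OF starting_block_path(1)[OF rt, of "min x x'" y z]])
        (use 1 d in \<open>auto simp: eq d_def\<close>)
  next
    case 2
    show ?thesis
      by (rule that[OF starting_block_path(2)[OF rt, of x "min y y'" z]])
        (use 2 d in \<open>auto simp: eq d_def\<close>)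
  next
    case 3
    show ?thesis
      by (rule that[OF starting_block_path(3)[OF rt, of x y "min z z'"]])
        (use 3 d in \<open>auto simp: eq d_def\<close>)
  qed
qed

text \<open>One block is chosen for each vertex and one for each edge; the box has finitely many of
  both.\<close>

lemma covering_blocks_exist:
  assumes rt: "1 \<le> r" "r \<le> t"
  obtains F where "covering_blocks t r (box_graph q m n k) F"
proof -
  let ?G = "box_graph q m n k"
  have "\<exists>H. starting_block t r H \<and> v \<in> verts H" for v
  proof -
    obtain x y z where "v = (x, y, z)"
      by (metis prod_cases3)
    \<comment> \<open>Any neighbour in the integer lattice will do, even one outside the box, since
      blocks may stick out.\<close>
    then have "l1dist v (x + 1, y, z) = 1"
      by simp
    then show ?thesis
      by (rule starting_block_edge[OF rt]) (metis verts_box_graph)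
  qed
  then obtain f where f: "\<And>v. starting_block t r (f v)" "\<And>v. v \<in> verts (f v)"
    by metis
  have "\<exists>H. starting_block t r H \<and> e \<in> edges H" if "e \<in> edges ?G" for e
  proof -
    obtain u v where e: "e = {u, v}"
      using \<open>e \<in> edges ?G\<close> by (auto simp: box_graph_def)
    then have "l1dist u v = 1"
      using \<open>e \<in> edges ?G\<close> by (simp add: edge_box_graph_iff)
    then show ?thesis
      by (rule starting_block_edge[OF rt]) (metis edge_box_graph_iff e \<open>l1dist u v = 1\<close>)
  qed
  then obtain g where g: "\<And>e. e \<in> edges ?G \<Longrightarrow> starting_block t r (g e)"
    "\<And>e. e \<in> edges ?G \<Longrightarrow> e \<in> edges (g e)"
    by metis
  have "edges ?G \<subseteq> Pow (verts ?G)"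
    by (auto simp: box_graph_def)
  then have "finite (edges ?G)"
    by (rule finite_subset) simp
  moreover have "finite (verts ?G)"
    by simp
  ultimately have "covering_blocks t r ?G (f ` verts ?G \<union> g ` edges ?G)"
    unfolding covering_blocks_def using f g by blast
  then show ?thesis
    by (rule that)
qed

theorem theorem1p3:
  fixes t r m n k B :: nat
  assumes "1 \<le> r" and "r \<le> t"
    and "0 < m" and "0 < n" and "0 < k"
    and "B = starting_blocks_required t r (grid_graph m n k)"
  shows "broadcast_domination_number t r (grid_graph m n k) \<le> 2 * B"
proof -
  let ?G = "grid_graph m n k"
  obtain F0 where "covering_blocks t r ?G F0"
    unfolding grid_graph_def by (rule covering_blocks_exist[OF assms(1,2)])
  then have "{card F | F. covering_blocks t r ?G F} \<noteq> {}"
    by blast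
  \<comment> \<open>As some cover exists, the infimum is attained, and an optimal cover can be
    turned into a dominating set.\<close>
  then have "B \<in> {card F | F. covering_blocks t r ?G F}"
    unfolding assms(6) starting_blocks_required_def by (rule Inf_nat_def1)
  then obtain F where F: "covering_blocks t r ?G F" "B = card F"
    by blast
  obtain T where T: "broadcast_dominating t r ?G T" "card T \<le> 2 * card F"
    using F(1) unfolding grid_graph_def by (rule covering_blocks_dominating[OF assms(3-5,2)])
  have "broadcast_domination_number t r ?G \<le> card T"
    unfolding broadcast_domination_number_def using T(1) by (intro cInf_lower) auto
  with T(2) F(2) show ?thesis
    by simp
qed

end
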